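(* Let $V$ be an $n$-dimensional real inner product space, let $b$ be the Bianchi operator, $*$ the star operator on double forms, and $t:D^{p,q}V^*\to D^{q,p}V^*$ the transpose of tensor factors. Then $$t\,{*}\,b=(-1)^{p+q-1}\,b\,{*}\,t$$ as maps $D^{p,q}V^*\to D^{n-q+1,\,n-p-1}V^*$.
   Context: $D^{p,q}V^*=\Lambda^pV^*\otimes\Lambda^qV^*$ is the space of $(p,q)$-double forms. The transpose is $t(\alpha\otimes\beta)=\beta\otimes\alpha$. Bianchi operator $b:D^{p,q}V^*\to D^{p+1,q-1}V^*$: $$b(T)_{i_1\dots i_{p+1}j_1\dots j_{q-1}}=\sum_{l=1}^{p+1}(-1)^lT_{i_1\dots\hat{i_l}\dots i_{p+1}\,i_l\,j_1\dots j_{q-1}},$$ where the hat denotes omission; equivalently, on basis elements with $e^{i_1\dots i_k}=e^{i_1}\wedge\dots\wedge e^{i_k}$, $$b(e^{i_1\dots i_p}\otimes e^{j_1\dots j_q})=\sum_{l=1}^q(-1)^le^{j_li_1\dots i_p}\otimes e^{j_1\dots\hat{j_l}\dots j_q}.$$ Star operator: $\Lambda^pV^*$ has the inner product for which $\{e^{i_1\dots i_p}:i_1<\dots<i_p\}$ is orthonormal when $\{e^i\}$ is an orthonormal basis of $V^*$. Choosing an orientation with volume element $\epsilon\in\Lambda^nV^*$, $*:\Lambda^pV^*\to\Lambda^{n-p}V^*$ is defined by $\alpha\wedge*\beta=(\alpha,\beta)\epsilon$. On double forms, $*(\alpha\otimes\beta)=*\alpha\otimes*\beta$, so $*:D^{p,q}V^*\to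 D^{n-p,n-q}V^*$; this is independent of the chosen orientation. *)

theory Defs
  imports "HOL-Analysis.Analysis"
begin

text \<open>
  Throughout, \<open>V\<close> is the whole type \<open>'v\<close>, and \<open>n = dim UNIV\<close>. An element of \<open>\<Lambda>\<^sup>k V\<^sup>*\<close> is an
  alternating \<open>k\<close>-linear function of a list of \<open>k\<close> vectors, extended by \<open>0\<close> to lists of any other
  length. Degrees are integers, so that the spaces of negative degree, which occur as targets
  such as \<open>D\<^sup>p\<^sup>+\<^sup>1\<^sup>,\<^sup>q\<^sup>-\<^sup>1\<close> for \<open>q = 0\<close>, are the zero space.
\<close>

definition finite_dimensional :: "'v::real_vector itself \<Rightarrow> bool" where
  "finite_dimensional _ \<longleftrightarrow> (\<exists>B::'v set. finite B \<and> span B = UNIV)"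

type_synonym 'v form = "'v list \<Rightarrow> real"
type_synonym 'v dform = "'v list \<Rightarrow> 'v list \<Rightarrow> real"

definition forms :: "int \<Rightarrow> 'v::real_vector form set" where
  "forms k = {\<omega>.
     (\<forall>xs. int (length xs) \<noteq> k \<longrightarrow> \<omega> xs = 0) \<and>
     (\<forall>xs. \<forall>i<length xs. linear (\<lambda>v. \<omega> (xs[i := v]))) \<and>
     (\<forall>xs i j. i < j \<and> j < length xs \<and> xs ! i = xs ! j \<longrightarrow> \<omega> xs = 0)}"

text \<open>
  The exterior product as a sum over shuffles: \<open>S\<close> is the set of positions whose vectors are fed
  to \<open>\<alpha>\<close>, and the exponent counts the inversions of the shuffle. There is no factorial, so that
  \<open>e\<^sup>1 \<and> \<dots> \<and> e\<^sup>k\<close> takes the value \<open>1\<close> on \<open>[e\<^sub>1, \<dots>, e\<^sub>k]\<close>. Only the summands with \<open>card S\<close> equal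
  to the degree of \<open>\<alpha>\<close> contribute.
\<close>

definition wedge :: "'v form \<Rightarrow> 'v form \<Rightarrow> 'v form" where
  "wedge \<alpha> \<beta> = (\<lambda>xs. \<Sum>S\<in>Pow {..<length xs}.
     (-1) ^ card {(i, j). i \<in> S \<and> j \<in> {..<length xs} - S \<and> j < i} *
     \<alpha> (nths xs S) * \<beta> (nths xs ({..<length xs} - S)))"

definition orthonormal_basis :: "'v::real_inner list \<Rightarrow> bool" where
  "orthonormal_basis E \<longleftrightarrow>
     (\<forall>i<length E. \<forall>j<length E. E ! i \<bullet> E ! j = (if i = j then 1 else 0)) \<and>
     span (set E) = UNIV"

definition onb :: "'v::real_inner list" where
  "onb = (SOME E. orthonormal_basis E)"

text \<open>
  For \<open>I = {i\<^sub>1 < \<dots> < i\<^sub>k}\<close>, \<open>nths onb I\<close> is \<open>[e\<^bsub>i\<^sub>1\<^esub>, \<dots>, e\<^bsub>i\<^sub>k\<^esub>]\<close>, and \<open>\<alpha> (nths onb I)\<close> is the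
  coefficient of \<open>\<alpha>\<close> at \<open>e\<^sup>i\<^sup>1 \<and> \<dots> \<and> e\<^sup>i\<^sup>k\<close>. Hence this is the inner product for which these
  products are orthonormal; it does not depend on the choice made in \<open>onb\<close>.
\<close>

definition form_inner :: "'v::real_inner form \<Rightarrow> 'v form \<Rightarrow> real" where
  "form_inner \<alpha> \<beta> =
     (\<Sum>I\<in>Pow {..<length (onb :: 'v list)}. \<alpha> (nths onb I) * \<beta> (nths onb I))"

text \<open>The two unit elements of \<open>\<Lambda>\<^sup>n V\<^sup>*\<close> correspond to the two orientations.\<close>

definition volume_element :: "'v::real_inner form \<Rightarrow> bool" where
  "volume_element \<epsilon> \<longleftrightarrow> \<epsilon> \<in> forms (int (dim (UNIV :: 'v set))) \<and> form_inner \<epsilon> \<epsilon> = 1"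

definition star :: "'v::real_inner form \<Rightarrow> int \<Rightarrow> 'v form \<Rightarrow> 'v form" where
  "star \<epsilon> p \<beta> = (THE \<gamma>. \<gamma> \<in> forms (int (dim (UNIV :: 'v set)) - p) \<and>
     (\<forall>\<alpha>\<in>forms p. wedge \<alpha> \<gamma> = (\<lambda>xs. form_inner \<alpha> \<beta> * \<epsilon> xs)))"

text \<open>
  The tensor product is realised inside the functions of two lists, with
  \<open>(\<alpha> \<otimes> \<beta>) xs ys = \<alpha> xs * \<beta> ys\<close>: \<open>tensor_rep p q T N \<alpha> \<beta>\<close> says that
  \<open>T = \<alpha>\<^sub>0 \<otimes> \<beta>\<^sub>0 + \<dots> + \<alpha>\<^sub>N\<^sub>-\<^sub>1 \<otimes> \<beta>\<^sub>N\<^sub>-\<^sub>1\<close>.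
\<close>

definition tensor :: "'v form \<Rightarrow> 'v form \<Rightarrow> 'v dform" where
  "tensor \<alpha> \<beta> = (\<lambda>xs ys. \<alpha> xs * \<beta> ys)"

definition tensor_rep ::
  "int \<Rightarrow> int \<Rightarrow> 'v::real_vector dform \<Rightarrow> nat \<Rightarrow> (nat \<Rightarrow> 'v form) \<Rightarrow> (nat \<Rightarrow> 'v form) \<Rightarrow> bool" where
  "tensor_rep p q T N \<alpha> \<beta> \<longleftrightarrow>
     (\<forall>i<N. \<alpha> i \<in> forms p \<and> \<beta> i \<in> forms q) \<and>
     T = (\<lambda>xs ys. \<Sum>i<N. tensor (\<alpha> i) (\<beta> i) xs ys)"

definition double_forms :: "int \<Rightarrow> int \<Rightarrow> 'v::real_vector dform set" where
  "double_forms p q = {T. \<exists>N \<alpha> \<beta>. tensor_rep p q T N \<alpha> \<beta>}"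

definition dtranspose :: "'v dform \<Rightarrow> 'v dform" where
  "dtranspose T = (\<lambda>xs ys. T ys xs)"

text \<open>
  Positions are counted from \<open>0\<close>, so position \<open>l\<close> carries the sign \<open>(-1)\<^sup>l\<^sup>+\<^sup>1\<close>.
  As \<open>T \<in> D\<^sup>p\<^sup>,\<^sup>q\<close> vanishes on lists of other lengths, the formula needs no degrees;
  for \<open>q = 0\<close> it gives \<open>0\<close>.
\<close>

definition bianchi :: "'v dform \<Rightarrow> 'v dform" where
  "bianchi T = (\<lambda>xs ys. \<Sum>l<length xs.
     (-1) ^ (l + 1) * T (take l xs @ drop (l + 1) xs) (xs ! l # ys))"

text \<open>The linear extension to \<open>D\<^sup>p\<^sup>,\<^sup>q\<close> of \<open>\<alpha> \<otimes> \<beta> \<mapsto> *\<alpha> \<otimes> *\<beta>\<close>.\<close>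

definition dstar :: "'v::real_inner form \<Rightarrow> int \<Rightarrow> int \<Rightarrow> 'v dform \<Rightarrow> 'v dform" where
  "dstar \<epsilon> p q T = (THE U. \<exists>N \<alpha> \<beta>. tensor_rep p q T N \<alpha> \<beta> \<and>
     U = (\<lambda>xs ys. \<Sum>i<N. tensor (star \<epsilon> p (\<alpha> i)) (star \<epsilon> q (\<beta> i)) xs ys))"

end

theory Submission
  imports Defs
begin

text \<open>
  Write \<open>e\<^sub>1, \<dots>, e\<^sub>n\<close> for an orthonormal basis, \<open>\<iota>\<^sub>v\<close> for the contraction that puts \<open>v\<close> in the first
  slot, and \<open>v\<wedge>\<close> for exterior multiplication by the covector \<open>x \<mapsto> x \<bullet> v\<close>. Expanding the vector
  that the Bianchi operator moves across the two factors in the basis gives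
  \<open>b(\<alpha> \<otimes> \<beta>) = - \<Sum>\<^sub>a (e\<^sub>a \<wedge> \<alpha>) \<otimes> \<iota>\<^sub>a \<beta>\<close> (\<open>bianchi_tensor_sum\<close>). The star operator exchanges the
  two operations that occur here: for \<open>\<alpha>\<close> of degree \<open>p\<close> and \<open>\<beta>\<close> of degree \<open>q\<close>,
  \<open>*(v \<wedge> \<alpha>) = (-1)\<^sup>p \<iota>\<^sub>v *\<alpha>\<close> and \<open>*(\<iota>\<^sub>v \<beta>) = (-1)\<^sup>q\<^sup>+\<^sup>1 v \<wedge> *\<beta>\<close> (\<open>hodge_ext_mult\<close>, \<open>hodge_contract\<close>).
  Hence \<open>*\<close> turns each summand \<open>(e\<^sub>a \<wedge> \<alpha>) \<otimes> \<iota>\<^sub>a \<beta>\<close> into \<open>\<iota>\<^sub>a *\<alpha> \<otimes> (e\<^sub>a \<wedge> *\<beta>)\<close> up to the common sign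
  \<open>(-1)\<^sup>p\<^sup>+\<^sup>q\<^sup>+\<^sup>1\<close>, and after the transpose these are the summands of \<open>b(*\<beta> \<otimes> *\<alpha>)\<close>.

  The defining property of the star, \<open>\<alpha> \<wedge> *\<beta> = (\<alpha>, \<beta>) \<epsilon>\<close>, is traded at once for a formula:
  \<open>*\<beta>\<close> is \<open>\<epsilon>\<close> contracted with \<open>\<beta>\<close>, that is
  \<open>(*\<beta>)(xs) = \<Sum>\<^sub>I \<beta>(e\<^sub>I) \<epsilon>(e\<^sub>I, xs)\<close> (\<open>star_eq_hodge\<close>). In this form the star on double forms visibly
  does not depend on how a double form is written as a sum of tensors (\<open>dstar_tensor_sum\<close>). The two
  exchange rules follow from it and from the adjointness of \<open>v\<wedge>\<close> and \<open>\<iota>\<^sub>v\<close> (\<open>ext_mult_adjoint\<close>);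
  the second one also uses that \<open>v \<wedge> \<epsilon> = 0\<close>, because its degree exceeds \<open>n\<close>. That the formula has the
  defining property rests on two facts: the exterior product of alternating forms is alternating
  (\<open>forms_wedge\<close>), and an alternating form vanishes when it vanishes on all increasing tuples of
  basis vectors (\<open>form_zero_span\<close>), so that identities of \<open>n\<close>-forms need only be checked on
  \<open>(e\<^sub>1, \<dots>, e\<^sub>n)\<close>.
\<close>

section \<open>Alternating forms\<close>

definition contract :: "'v \<Rightarrow> 'v form \<Rightarrow> 'v form" where
  "contract x \<omega> = (\<lambda>xs. \<omega> (x # xs))"

lemma forms_length: "\<omega> \<in> forms k \<Longrightarrow> int (length xs) \<noteq> k \<Longrightarrow> \<omega> xs = 0"
  by (simp add: forms_def)

lemma forms_linear:
  assumes "\<omega> \<in> forms k" shows "linear (\<lambda>v. \<omega> (as @ v # bs))"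
proof -
  have "linear (\<lambda>v. \<omega> ((as @ 0 # bs)[length as := v]))"
    using assms unfolding forms_def mem_Collect_eq
    by (elim conjE allE[of _ "as @ 0 # bs"] allE[of _ "length as"]) simp
  then show ?thesis by simp
qed

lemmas forms_linear_Cons = forms_linear[where as = "[]", simplified]

lemma forms_repeat:
  assumes "\<omega> \<in> forms k" "\<not> distinct xs" shows "\<omega> xs = 0"
proof -
  obtain i j where "i < length xs" "j < length xs" "i \<noteq> j" "xs ! i = xs ! j"
    using assms(2) by (auto simp: distinct_conv_nth)
  moreover have "\<omega> xs = 0" if "i < j" "j < length xs" "xs ! i = xs ! j" for i j
    using assms(1) that unfolding forms_def by blast
  ultimately show ?thesis by (metis linorder_neqE_nat)
qed

lemma not_distinctI: "i < j \<Longrightarrow> j < length xs \<Longrightarrow> xs ! i = xs ! j \<Longrightarrow> \<not> distinct xs"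
  by (metis distinct_conv_nth less_trans nat_neq_iff)

lemma forms_neg: "\<omega> \<in> forms k \<Longrightarrow> k < 0 \<Longrightarrow> \<omega> = (\<lambda>_. 0)"
  by (rule ext) (rule forms_length, auto)

lemma forms_zero: "(\<lambda>_. 0) \<in> forms k"
  by (simp add: forms_def linear_zero)

lemma forms_add: "\<alpha> \<in> forms k \<Longrightarrow> \<beta> \<in> forms k \<Longrightarrow> (\<lambda>xs. \<alpha> xs + \<beta> xs) \<in> forms k"
  by (simp add: forms_def linear_compose_add)

lemma forms_cmul: "\<alpha> \<in> forms k \<Longrightarrow> (\<lambda>xs. c * \<alpha> xs) \<in> forms k"
  using linear_compose_scale_right[where c = c and 'b = real] unfolding forms_def by auto

lemma forms_uminus: "\<alpha> \<in> forms k \<Longrightarrow> (\<lambda>xs. - \<alpha> xs) \<in> forms k"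
  using forms_cmul[of \<alpha> k "-1"] by simp

lemma forms_sum: "(\<And>i. i \<in> A \<Longrightarrow> \<alpha> i \<in> forms k) \<Longrightarrow> (\<lambda>xs. \<Sum>i\<in>A. \<alpha> i xs) \<in> forms k"
  by (induction A rule: infinite_finite_induct) (simp_all add: forms_zero forms_add)

lemma forms_embed:
  assumes "\<omega> \<in> forms k"
  shows "(\<lambda>ys. \<omega> (as @ ys @ bs)) \<in> forms (k - int (length as) - int (length bs))"
proof -
  have "linear (\<lambda>v. \<omega> (as @ xs[i := v] @ bs))" if "i < length xs" for xs i
    using forms_linear[OF assms, of "as @ take i xs" "drop (Suc i) xs @ bs"] that
    by (simp add: upd_conv_take_nth_drop)
  moreover have "\<omega> (as @ xs @ bs) = 0" if "i < j" "j < length xs" "xs ! i = xs ! j" for xs i j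
    using not_distinctI[OF that] by (intro forms_repeat[OF assms]) simp
  moreover have "\<omega> (as @ xs @ bs) = 0" if "int (length xs) \<noteq> k - int (length as) - int (length bs)" for xs
    using that by (intro forms_length[OF assms]) auto
  ultimately show ?thesis
    unfolding forms_def by blast
qed

lemma forms_contract:
  assumes "\<omega> \<in> forms k" shows "contract x \<omega> \<in> forms (k - 1)"
  using forms_embed[OF assms, of "[x]" "[]"] by (simp add: contract_def)

text \<open>
  Polarisation: the form vanishes when both neighbours are replaced by \<open>x + y\<close>.
\<close>

lemma forms_swap:
  assumes "\<omega> \<in> forms k" shows "\<omega> (as @ x # y # bs) = - \<omega> (as @ y # x # bs)"
proof -
  have l1: "\<omega> (as @ (u + v) # w # bs) = \<omega> (as @ u # w # bs) + \<omega> (as @ v # w # bs)" for u v w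
    using linear_add[OF forms_linear[OF assms, of as "w # bs"]] .
  have l2: "\<omega> (as @ w # (u + v) # bs) = \<omega> (as @ w # u # bs) + \<omega> (as @ w # v # bs)" for u v w
    using linear_add[OF forms_linear[OF assms, of "as @ [w]" bs]] by simp
  have r: "\<omega> (as @ u # u # bs) = 0" for u
    by (rule forms_repeat[OF assms]) simp
  show ?thesis
    using r[of "x + y"] unfolding l1 l2 by (simp add: r)
qed

lemma forms_move:
  assumes "\<omega> \<in> forms k"
  shows "\<omega> (cs @ as @ x # bs) = (-1) ^ length as * \<omega> (cs @ x # as @ bs)"
proof (induction as arbitrary: cs)
  case (Cons a as)
  show ?case
    using Cons[of "cs @ [a]"] forms_swap[OF assms, of cs a x "as @ bs"] by simp
qed simp

text \<open>
  This makes it possible to recognise alternating forms by induction on the degree. Once all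
  contractions are alternating, only a repetition that involves the first position remains, and
  moving the second occurrence next to the first reduces it to the case of two neighbours.
\<close>

lemma formsI_contract:
  assumes empty: "k \<noteq> 0 \<Longrightarrow> \<omega> [] = 0"
    and contr: "\<And>x. contract x \<omega> \<in> forms (k - 1)"
    and lin: "\<And>xs. linear (\<lambda>x. \<omega> (x # xs))"
    and alt: "\<And>x xs. \<omega> (x # x # xs) = 0"
  shows "\<omega> \<in> forms k"
proof -
  have "\<omega> xs = 0" if "int (length xs) \<noteq> k" for xs
  proof (cases xs)
    case (Cons y ys)
    then show ?thesis
      using forms_length[OF contr, of ys y] that by (simp add: contract_def)
  qed (use empty that in simp)
  moreover have "linear (\<lambda>v. \<omega> (xs[i := v]))" if "i < length xs" for xs i
  proof (cases xs)
    case (Cons y ys)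
    show ?thesis
    proof (cases i)
      case (Suc j)
      have "linear (\<lambda>v. contract y \<omega> (ys[j := v]))"
        using contr[of y] that Cons Suc by (simp add: forms_def)
      then show ?thesis using Cons Suc by (simp add: contract_def)
    qed (use lin Cons in simp)
  qed (use that in simp)
  moreover have "\<omega> xs = 0" if "i < j" "j < length xs" "xs ! i = xs ! j" for xs i j
  proof (cases xs)
    case (Cons y ys)
    obtain j' where j: "j = Suc j'" using \<open>i < j\<close> by (cases j) auto
    show ?thesis
    proof (cases i)
      case 0
      have ys: "ys = take j' ys @ y # drop (Suc j') ys"
        using that Cons j 0 by (simp add: id_take_nth_drop[symmetric])
      have "contract y \<omega> ys = (-1) ^ length (take j' ys) * \<omega> (y # y # take j' ys @ drop (Suc j') ys)"
        using forms_move[OF contr, of y "[]" "take j' ys" y "drop (Suc j') ys"] ys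
        by (simp add: contract_def)
      then show ?thesis using Cons alt by (simp add: contract_def)
    next
      case (Suc i')
      then have "contract y \<omega> ys = 0"
        using that Cons j not_distinctI[of i' j' ys] by (intro forms_repeat[OF contr]) simp
      then show ?thesis using Cons by (simp add: contract_def)
    qed
  qed (use that in simp)
  ultimately show ?thesis
    by (auto simp: forms_def)
qed

lemma contract_contract_same: "\<omega> \<in> forms k \<Longrightarrow> contract x (contract x \<omega>) = (\<lambda>_. 0)"
  by (rule ext) (simp add: contract_def forms_repeat)

lemma contract_anticommute:
  "\<omega> \<in> forms k \<Longrightarrow> contract x (contract y \<omega>) = (\<lambda>xs. - contract y (contract x \<omega>) xs)"
  unfolding contract_def using forms_swap[of \<omega> k "[]"] by (metis append_Nil)

lemma forms_combine:
  assumes "\<omega> \<in> forms k"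
  shows "\<omega> (as @ (c *\<^sub>R u + v) # bs) = c * \<omega> (as @ u # bs) + \<omega> (as @ v # bs)"
  using linear_add[OF forms_linear[OF assms, of as bs]] linear_scale[OF forms_linear[OF assms, of as bs]]
  by simp

section \<open>Subsets of positions and shuffles\<close>

text \<open>
  Sums over \<open>nths xs S\<close> are treated by recursion on \<open>xs\<close>: a set of positions of \<open>x # xs\<close> is a set of
  positions of \<open>xs\<close>, shifted by one, with or without the position \<open>0\<close> of \<open>x\<close>.
\<close>

lemma sum_Pow_Suc:
  "(\<Sum>S\<in>Pow {..<Suc m}. f S) =
     (\<Sum>S\<in>Pow {..<m}. f (Suc ` S)) + (\<Sum>S\<in>Pow {..<m}. f (insert 0 (Suc ` S)))"
proof -
  have inj: "inj_on ((`) Suc) X" "inj_on (\<lambda>S. insert 0 (Suc ` S)) X" for X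
    by (auto simp: inj_on_def inj_image_eq_iff insert_ident)
  have "Pow {..<Suc m} = (`) Suc ` Pow {..<m} \<union> (\<lambda>S. insert 0 (Suc ` S)) ` Pow {..<m}"
    by (simp add: lessThan_Suc_eq_insert_0 Pow_insert image_Pow_surj image_image
        flip: image_image[of "insert 0" "(`) Suc"])
  moreover have "(`) Suc ` Pow {..<m} \<inter> (\<lambda>S. insert 0 (Suc ` S)) ` Pow {..<m} = {}"
    by auto
  ultimately show ?thesis
    by (simp add: sum.union_disjoint sum.reindex[OF inj(1)] sum.reindex[OF inj(2)])
qed

lemma nths_shift:
  "nths (x # xs) (Suc ` S) = nths xs S"
  "nths (x # xs) (insert 0 (Suc ` S)) = x # nths xs S"
  by (auto simp: nths_Cons image_iff)

lemma length_nths_subset: "S \<subseteq> {..<length xs} \<Longrightarrow> length (nths xs S) = card S"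
  by (auto simp: length_nths intro!: arg_cong[where f = card])

definition inversions :: "nat \<Rightarrow> nat set \<Rightarrow> nat" where
  "inversions m S = card {(i, j). i \<in> S \<and> j \<in> {..<m} - S \<and> j < i}"

lemma inversions_shift:
  assumes "S \<subseteq> {..<m}"
  shows "inversions (Suc m) (insert 0 (Suc ` S)) = inversions m S"
    and "inversions (Suc m) (Suc ` S) = card S + inversions m S"
proof -
  let ?P = "{(i, j). i \<in> S \<and> j \<in> {..<m} - S \<and> j < i}"
  have fin: "finite ?P" "finite S"
    using assms finite_subset[of ?P "{..<m} \<times> {..<m}"] finite_subset[of S] by auto
  have shift: "{(i, j). i \<in> Suc ` S \<and> j \<in> Suc ` ({..<m} - S) \<and> j < i} = map_prod Suc Suc ` ?P"
    by force
  have "{(i, j). i \<in> insert 0 (Suc ` S) \<and> j \<in> {..<Suc m} - insert 0 (Suc ` S) \<and> j < i}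
      = {(i, j). i \<in> Suc ` S \<and> j \<in> Suc ` ({..<m} - S) \<and> j < i}"
    by (auto simp: lessThan_Suc_eq_insert_0)
  then show "inversions (Suc m) (insert 0 (Suc ` S)) = inversions m S"
    by (simp add: inversions_def shift card_image prod.inj_map inj_on_subset[OF prod.inj_map])
  have "{(i, j). i \<in> Suc ` S \<and> j \<in> {..<Suc m} - Suc ` S \<and> j < i}
      = (\<lambda>i. (Suc i, 0)) ` S \<union> map_prod Suc Suc ` ?P"
    unfolding shift[symmetric] by (auto simp: lessThan_Suc_eq_insert_0)
  moreover have "card ((\<lambda>i. (Suc i, 0::nat)) ` S) = card S"
    by (intro card_image) (auto simp: inj_on_def)
  moreover have "card (map_prod Suc Suc ` ?P) = card ?P"
    by (intro card_image) (auto simp: inj_on_def)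
  moreover have "(\<lambda>i. (Suc i, 0)) ` S \<inter> map_prod Suc Suc ` ?P = {}" by auto
  ultimately show "inversions (Suc m) (Suc ` S) = card S + inversions m S"
    using fin by (simp add: inversions_def card_Un_disjoint)
qed

lemma compl_shift:
  "{..<Suc m} - insert 0 (Suc ` S) = Suc ` ({..<m} - S)"
  "{..<Suc m} - Suc ` S = insert 0 (Suc ` ({..<m} - S))"
  by (auto simp: lessThan_Suc_eq_insert_0)

section \<open>The exterior product of alternating forms\<close>

lemma wedge_eq: "wedge \<alpha> \<beta> xs = (\<Sum>S\<in>Pow {..<length xs}.
    (-1) ^ inversions (length xs) S * \<alpha> (nths xs S) * \<beta> (nths xs ({..<length xs} - S)))"
  by (simp add: wedge_def inversions_def)

text \<open>
  The Leibniz rule for contractions. The shuffles that give \<open>x\<close> to \<open>\<beta>\<close> move it past the \<open>p\<close>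
  arguments of \<open>\<alpha>\<close>, whence the sign.
\<close>

lemma wedge_Cons:
  assumes "\<alpha> \<in> forms (int p)"
  shows "wedge \<alpha> \<beta> (x # xs) = wedge (contract x \<alpha>) \<beta> xs + (-1) ^ p * wedge \<alpha> (contract x \<beta>) xs"
proof -
  have "(\<Sum>S\<in>Pow {..<length xs}. (-1) ^ inversions (Suc (length xs)) (Suc ` S) *
      \<alpha> (nths xs S) * \<beta> (x # nths xs ({..<length xs} - S))) = (-1) ^ p * wedge \<alpha> (contract x \<beta>) xs"
    unfolding wedge_eq sum_distrib_left
  proof (rule sum.cong[OF refl])
    fix S assume "S \<in> Pow {..<length xs}"
    then have S: "S \<subseteq> {..<length xs}" by simp
    show "(-1) ^ inversions (Suc (length xs)) (Suc ` S) * \<alpha> (nths xs S) * \<beta> (x # nths xs ({..<length xs} - S))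
       = (-1) ^ p * ((-1) ^ inversions (length xs) S * \<alpha> (nths xs S) * contract x \<beta> (nths xs ({..<length xs} - S)))"
    proof (cases "card S = p")
      case True
      then show ?thesis by (simp add: inversions_shift[OF S] power_add contract_def)
    next
      case False
      then have "\<alpha> (nths xs S) = 0"
        by (intro forms_length[OF assms]) (simp add: length_nths_subset[OF S])
      then show ?thesis by simp
    qed
  qed
  moreover have "(\<Sum>S\<in>Pow {..<length xs}. (-1) ^ inversions (Suc (length xs)) (insert 0 (Suc ` S)) *
      \<alpha> (x # nths xs S) * \<beta> (nths xs ({..<length xs} - S))) = wedge (contract x \<alpha>) \<beta> xs"
    unfolding wedge_eq by (rule sum.cong) (simp_all add: inversions_shift(1) contract_def)
  ultimately show ?thesis
    unfolding wedge_eq[of _ _ "x # xs"]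
    by (simp add: sum_Pow_Suc nths_shift compl_shift del: lessThan_Suc)
qed

text \<open>
  The sign in the exterior product is the sign of the permutation that sorts
  \<open>nths xs S @ nths xs ({..<length xs} - S)\<close>. The prefix \<open>cs\<close> collects the vectors that the induction
  has already put in place.
\<close>

lemma forms_shuffle:
  assumes "\<omega> \<in> forms k" "S \<subseteq> {..<length xs}"
  shows "\<omega> (cs @ nths xs S @ nths xs ({..<length xs} - S)) =
           (-1) ^ inversions (length xs) S * \<omega> (cs @ xs)"
  using assms(2)
proof (induction xs arbitrary: cs S)
  case Nil
  then show ?case by (simp add: inversions_def)
next
  case (Cons x xs)
  obtain S' where S': "S' \<subseteq> {..<length xs}" "S = Suc ` S' \<or> S = insert 0 (Suc ` S')"
  proof -
    have "S - {0} \<subseteq> Suc ` {..<length xs}"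
      using Cons.prems by (auto simp: lessThan_Suc_eq_insert_0)
    then obtain S' where "S' \<subseteq> {..<length xs}" "S - {0} = Suc ` S'"
      by (meson subset_imageE)
    then show ?thesis by (intro that[of S']) auto
  qed
  from S'(2) show ?case
  proof
    assume S: "S = Suc ` S'"
    have "\<omega> (cs @ nths xs S' @ x # nths xs ({..<length xs} - S'))
        = (-1) ^ card S' * \<omega> ((cs @ [x]) @ nths xs S' @ nths xs ({..<length xs} - S'))"
      using forms_move[OF assms(1), of cs "nths xs S'" x] by (simp add: length_nths_subset S'(1))
    then show ?case
      using Cons.IH[OF S'(1), of "cs @ [x]"]
      by (simp add: S compl_shift nths_shift inversions_shift[OF S'(1)] power_add del: lessThan_Suc)
  next
    assume S: "S = insert 0 (Suc ` S')"
    show ?case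
      using Cons.IH[OF S'(1), of "cs @ [x]"]
      by (simp add: S compl_shift nths_shift inversions_shift[OF S'(1)] del: lessThan_Suc)
  qed
qed

lemma wedge_zero [simp]: "wedge (\<lambda>_. 0) \<beta> = (\<lambda>_. 0)" "wedge \<alpha> (\<lambda>_. 0) = (\<lambda>_. 0)"
  by (simp_all add: wedge_def)

lemma linear_wedge:
  fixes f g :: "'a::real_vector \<Rightarrow> 'v form"
  assumes "\<And>xs. linear (\<lambda>v. f v xs)" "\<And>xs. linear (\<lambda>v. g v xs)"
  shows "linear (\<lambda>v. wedge (f v) \<beta> xs)" "linear (\<lambda>v. wedge \<alpha> (g v) xs)"
proof -
  have r: "linear (\<lambda>v. h v * c)" if "linear h" for h :: "'a \<Rightarrow> real" and c
    using linear_compose_scale_right[OF that, of c] by (simp add: mult.commute)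
  have l: "linear (\<lambda>v. c * h v)" if "linear h" for h :: "'a \<Rightarrow> real" and c
    using linear_compose_scale_right[OF that, of c] by simp
  show "linear (\<lambda>v. wedge (f v) \<beta> xs)" "linear (\<lambda>v. wedge \<alpha> (g v) xs)"
    unfolding wedge_def by (intro linear_compose_sum ballI r l assms)+
qed

text \<open>
  Induction on the total degree with the Leibniz rule. A repeated first vector is handled by applying
  the rule twice: the two mixed terms, in which each factor receives one copy, have opposite signs.
\<close>

lemma forms_wedge:
  assumes "\<alpha> \<in> forms a" "\<beta> \<in> forms b"
  shows "wedge \<alpha> \<beta> \<in> forms (a + b)"
proof (cases "a < 0 \<or> b < 0")
  case True
  then show ?thesis
    using forms_neg[OF assms(1)] forms_neg[OF assms(2)] forms_zero by auto
next
  case False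
  then obtain m where "a + b = int m"
    by (metis add_nonneg_nonneg int_ops(1) linorder_not_less nonneg_int_cases)
  then show ?thesis
    using assms False
  proof (induction m arbitrary: a b \<alpha> \<beta>)
    case 0
    then have "a = 0" "b = 0" by auto
    then have forms0: "\<alpha> \<in> forms 0" "\<beta> \<in> forms 0" using 0 by auto
    then have "contract x \<alpha> = (\<lambda>_. 0)" "contract x \<beta> = (\<lambda>_. 0)" for x
      using forms_neg[OF forms_contract[OF forms0(1)], of x]
        forms_neg[OF forms_contract[OF forms0(2)], of x] by auto
    then have Cons: "wedge \<alpha> \<beta> (x # xs) = 0" for x xs
      using wedge_Cons[of \<alpha> 0 \<beta> x xs] forms0(1) by simp
    have "wedge \<alpha> \<beta> \<in> forms 0"
      by (rule formsI_contract)
        (simp_all add: contract_def[of _ "wedge \<alpha> \<beta>"] Cons forms_zero linear_zero)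
    then show ?case
      using \<open>a = 0\<close> \<open>b = 0\<close> by simp
  next
    case (Suc m)
    obtain p where p: "a = int p" using Suc.prems by (metis linorder_not_less nonneg_int_cases)
    note Leibniz = wedge_Cons[OF Suc.prems(2)[unfolded p]]
    have contract_left: "wedge (contract x \<alpha>) \<beta> \<in> forms (a + b - 1)" for x
    proof (cases "a = 0")
      case True
      then have "contract x \<alpha> = (\<lambda>_. 0)"
        using forms_neg[OF forms_contract[OF Suc.prems(2), of x]] by simp
      then show ?thesis by (simp add: forms_zero)
    next
      case False
      then show ?thesis
        using Suc.IH[OF _ forms_contract[OF Suc.prems(2), of x] Suc.prems(3)] Suc.prems
        by (simp add: algebra_simps)
    qed
    have contract_right: "wedge \<alpha> (contract x \<beta>) \<in> forms (a + b - 1)" for x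
    proof (cases "b = 0")
      case True
      then have "contract x \<beta> = (\<lambda>_. 0)"
        using forms_neg[OF forms_contract[OF Suc.prems(3), of x]] by simp
      then show ?thesis by (simp add: forms_zero)
    next
      case False
      then show ?thesis
        using Suc.IH[OF _ Suc.prems(2) forms_contract[OF Suc.prems(3), of x]] Suc.prems
        by (simp add: algebra_simps)
    qed
    show ?case
    proof (rule formsI_contract)
      assume "a + b \<noteq> 0"
      then have "\<alpha> [] = 0 \<or> \<beta> [] = 0"
        using forms_length[OF Suc.prems(2), of "[]"] forms_length[OF Suc.prems(3), of "[]"] by fastforce
      then show "wedge \<alpha> \<beta> [] = 0" by (auto simp: wedge_def)
    next
      fix x
      have "contract x (wedge \<alpha> \<beta>) =
          (\<lambda>xs. wedge (contract x \<alpha>) \<beta> xs + (-1) ^ p * wedge \<alpha> (contract x \<beta>) xs)"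
        by (rule ext) (simp add: contract_def[of x "wedge \<alpha> \<beta>"] Leibniz)
      then show "contract x (wedge \<alpha> \<beta>) \<in> forms (a + b - 1)"
        using contract_left contract_right by (simp add: forms_add forms_cmul)
    next
      fix xs
      have lin: "linear (\<lambda>x. contract x \<omega> ys)" if "\<omega> \<in> forms k" for \<omega> :: "'a form" and k ys
        using forms_linear_Cons[OF that] by (simp add: contract_def)
      have "linear (\<lambda>x. (-1) ^ p * wedge \<alpha> (contract x \<beta>) xs)"
        using linear_compose_scale_right[OF linear_wedge(2)[OF lin lin, OF Suc.prems(2,3)]] by simp
      then show "linear (\<lambda>x. wedge \<alpha> \<beta> (x # xs))"
        unfolding Leibniz
        by (intro linear_compose_add linear_wedge(1)[OF lin lin, OF Suc.prems(2,3)])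
    next
      fix x xs
      show "wedge \<alpha> \<beta> (x # x # xs) = 0"
      proof (cases p)
        case 0
        then have "contract x \<alpha> = (\<lambda>_. 0)"
          using forms_neg[OF forms_contract[OF Suc.prems(2), of x]] p by simp
        then show ?thesis
          by (simp add: Leibniz contract_contract_same[OF Suc.prems(3)])
      next
        case (Suc p')
        have "contract x \<alpha> \<in> forms (int p')"
          using forms_contract[OF Suc.prems(2), of x] p Suc by simp
        note Leibniz' = wedge_Cons[OF this]
        show ?thesis
          by (simp add: Leibniz Leibniz' contract_contract_same[OF Suc.prems(2)]
              contract_contract_same[OF Suc.prems(3)] Suc)
      qed
    qed
  qed
qed

section \<open>Exterior multiplication by a covector\<close>

text \<open>
  The exterior product of the covector \<open>x \<mapsto> x \<bullet> v\<close> with \<open>\<alpha>\<close>. The sum over the position of the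
  vector fed to the covector is the shape in which it occurs in the Bianchi operator.
\<close>

definition ext_mult :: "'v::real_inner \<Rightarrow> 'v form \<Rightarrow> 'v form" where
  "ext_mult v \<alpha> = (\<lambda>xs. \<Sum>l<length xs. (-1) ^ l * (xs ! l \<bullet> v) * \<alpha> (take l xs @ drop (l + 1) xs))"

lemma ext_mult_Nil [simp]: "ext_mult v \<alpha> [] = 0"
  by (simp add: ext_mult_def)

lemma ext_mult_Cons: "ext_mult v \<alpha> (x # xs) = (x \<bullet> v) * \<alpha> xs - ext_mult v (contract x \<alpha>) xs"
  unfolding ext_mult_def length_Cons sum.lessThan_Suc_shift
  by (simp add: contract_def sum_negf[symmetric])

lemma ext_mult_zero [simp]: "ext_mult v (\<lambda>_. 0) = (\<lambda>_. 0)"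
  by (simp add: ext_mult_def)

lemma linear_ext_mult:
  assumes "\<And>xs. linear (\<lambda>x. f x xs)" shows "linear (\<lambda>x. ext_mult v (f x) xs)"
proof -
  have "linear (\<lambda>x. c * f x xs)" for c xs
    using linear_compose_scale_right[OF assms, of c] by simp
  then show ?thesis
    unfolding ext_mult_def by (intro linear_compose_sum ballI)
qed

lemma forms_ext_mult:
  assumes "\<alpha> \<in> forms k" shows "ext_mult v \<alpha> \<in> forms (k + 1)"
proof (cases "k < 0")
  case True
  then show ?thesis using forms_neg[OF assms] forms_zero by simp
next
  case False
  then obtain m where "k = int m" by (metis linorder_not_less nonneg_int_cases)
  then show ?thesis
    using assms
  proof (induction m arbitrary: k \<alpha>)
    case 0
    have "contract x \<alpha> = (\<lambda>_. 0)" for x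
      using forms_neg[OF forms_contract[OF 0(2), of x]] 0 by simp
    note Cons = ext_mult_Cons[of v \<alpha>, unfolded this]
    have "contract x (ext_mult v \<alpha>) = (\<lambda>xs. (x \<bullet> v) * \<alpha> xs)" for x
      by (rule ext) (simp add: contract_def[of x "ext_mult v \<alpha>"] Cons)
    moreover have "\<alpha> (x # xs) = 0" for x xs
      using 0 by (intro forms_length) auto
    moreover have "linear (\<lambda>x. (x \<bullet> v) * \<alpha> xs)" for xs
      by (simp add: linear_iff algebra_simps)
    ultimately show ?case
      using forms_cmul[OF 0(2)] by - (rule formsI_contract, simp_all add: Cons)
  next
    case (Suc m)
    have IH: "ext_mult v (contract x \<alpha>) \<in> forms k" for x
      using Suc.IH[OF _ forms_contract[OF Suc.prems(2), of x]] Suc.prems(1) by (simp add: add.commute)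
    show ?case
    proof (rule formsI_contract)
      fix x
      have "contract x (ext_mult v \<alpha>) = (\<lambda>xs. (x \<bullet> v) * \<alpha> xs + - ext_mult v (contract x \<alpha>) xs)"
        by (rule ext) (simp add: contract_def[of x "ext_mult v \<alpha>"] ext_mult_Cons)
      also have "\<dots> \<in> forms k"
        by (intro forms_add forms_cmul forms_uminus IH Suc.prems)
      finally show "contract x (ext_mult v \<alpha>) \<in> forms (k + 1 - 1)" by simp
    next
      fix xs
      have "linear (\<lambda>x. (x \<bullet> v) * \<alpha> xs)"
        by (simp add: linear_iff algebra_simps)
      moreover have "linear (\<lambda>x. contract x \<alpha> ys)" for ys
        using forms_linear_Cons[OF Suc.prems(2)] by (simp add: contract_def)
      ultimately show "linear (\<lambda>x. ext_mult v \<alpha> (x # xs))"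
        unfolding ext_mult_Cons by (intro linear_compose_sub linear_ext_mult)
    next
      fix x xs
      show "ext_mult v \<alpha> (x # x # xs) = 0"
        by (simp add: ext_mult_Cons contract_contract_same[OF Suc.prems(2)])
          (simp add: contract_def)
    qed simp
  qed
qed

section \<open>Forms are determined by their coefficients\<close>

text \<open>
  The list \<open>zs\<close> holds the vectors already reduced to \<open>span X\<close>. The next vector is \<open>c e + y\<close> with
  \<open>y\<close> in \<open>span X\<close>; in the term with \<open>e\<close>, moving \<open>e\<close> to the front gives zero, and \<open>y\<close> joins \<open>zs\<close>.
\<close>

lemma form_zero_span_step:
  assumes \<omega>: "\<omega> \<in> forms k"
    and low: "\<And>ys. set ys \<subseteq> span X \<Longrightarrow> \<omega> ys = 0"
    and head: "\<And>ys. set ys \<subseteq> span (insert e X) \<Longrightarrow> \<omega> (e # ys) = 0"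
    and "set zs \<subseteq> span X" "set xs \<subseteq> span (insert e X)"
  shows "\<omega> (zs @ xs) = 0"
  using assms(4,5)
proof (induction xs arbitrary: zs)
  case (Cons x xs)
  then obtain c where "x - c *\<^sub>R e \<in> span X" by (auto simp: span_breakdown_eq)
  define y where "y = x - c *\<^sub>R e"
  have x: "x = c *\<^sub>R e + y" by (simp add: y_def)
  have "\<omega> (zs @ x # xs) = c * \<omega> (zs @ e # xs) + \<omega> (zs @ y # xs)"
    unfolding x by (rule forms_combine[OF \<omega>])
  moreover have "set (zs @ xs) \<subseteq> span (insert e X)"
    using Cons.prems span_mono[of X "insert e X"] by auto
  then have "\<omega> (zs @ e # xs) = 0"
    using forms_move[OF \<omega>, of "[]" zs e xs] head by simp
  moreover have "\<omega> (zs @ y # xs) = 0"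
    using Cons.IH[of "zs @ [y]"] Cons.prems \<open>x - c *\<^sub>R e \<in> span X\<close> by (simp add: y_def)
  ultimately show ?case by simp
qed (use low in simp)

text \<open>
  Induction on \<open>E\<close>: the coefficients of \<open>\<omega>\<close> with respect to \<open>e # E\<close> are those of \<open>\<omega>\<close> and of its
  contraction with \<open>e\<close> with respect to \<open>E\<close>, so both vanish on the span of \<open>E\<close>. As the contraction
  itself vanishes as soon as \<open>e\<close> is one of its arguments, the preceding lemma extends this to the
  span of \<open>e # E\<close> first for the contraction and then for \<open>\<omega>\<close>.
\<close>

lemma form_zero_span:
  assumes "\<omega> \<in> forms k"
    and "\<And>I. I \<subseteq> {..<length E} \<Longrightarrow> \<omega> (nths E I) = 0"
    and "set xs \<subseteq> span (set E)"
  shows "\<omega> xs = 0"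
  using assms
proof (induction E arbitrary: \<omega> k xs)
  case Nil
  show ?case
  proof (cases xs)
    case (Cons x xs')
    then show ?thesis
      using Nil.prems(3) linear_0[OF forms_linear_Cons[OF Nil.prems(1), of xs']] by simp
  qed (use Nil.prems(2)[of "{}"] in simp)
next
  case (Cons e E)
  have low: "\<omega> ys = 0" if "set ys \<subseteq> span (set E)" for ys
  proof (rule Cons.IH[OF Cons.prems(1) _ that])
    fix I assume "I \<subseteq> {..<length E}"
    then show "\<omega> (nths E I) = 0"
      using Cons.prems(2)[of "Suc ` I"] by (auto simp: nths_shift)
  qed
  have contr: "contract e \<omega> \<in> forms (k - 1)"
    by (rule forms_contract[OF Cons.prems(1)])
  have low': "contract e \<omega> ys = 0" if "set ys \<subseteq> span (set E)" for ys
  proof (rule Cons.IH[OF contr _ that])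
    fix I assume "I \<subseteq> {..<length E}"
    then show "contract e \<omega> (nths E I) = 0"
      using Cons.prems(2)[of "insert 0 (Suc ` I)"] by (auto simp: nths_shift contract_def)
  qed
  have "contract e \<omega> ys = 0" if "set ys \<subseteq> span (insert e (set E))" for ys
    using form_zero_span_step[OF contr low', where e = e and zs = "[]" and xs = ys] that
    by (simp add: contract_def forms_repeat[OF Cons.prems(1)] span_zero)
  then show ?case
    using form_zero_span_step[OF Cons.prems(1) low, where e = e and zs = "[]" and xs = xs] Cons.prems(3)
    by (simp add: contract_def)
qed

section \<open>Adjointness of exterior multiplication and contraction\<close>

text \<open>
  For an arbitrary list \<open>E\<close>, since the recursion on \<open>E\<close> below passes through lists that are not bases.
\<close>

definition coeff_inner :: "'v list \<Rightarrow> 'v form \<Rightarrow> 'v form \<Rightarrow> real" where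
  "coeff_inner E \<alpha> \<beta> = (\<Sum>I\<in>Pow {..<length E}. \<alpha> (nths E I) * \<beta> (nths E I))"

lemma coeff_inner_Nil: "coeff_inner [] \<alpha> \<beta> = \<alpha> [] * \<beta> []"
  by (simp add: coeff_inner_def)

lemma coeff_inner_Cons: "coeff_inner (e # E) \<alpha> \<beta> = coeff_inner E \<alpha> \<beta> + coeff_inner E (contract e \<alpha>) (contract e \<beta>)"
  by (simp add: coeff_inner_def sum_Pow_Suc nths_shift contract_def del: lessThan_Suc)

lemma coeff_inner_add_left: "coeff_inner E (\<lambda>xs. \<alpha> xs + \<alpha>' xs) \<beta> = coeff_inner E \<alpha> \<beta> + coeff_inner E \<alpha>' \<beta>"
  by (simp add: coeff_inner_def sum.distrib algebra_simps)

lemma coeff_inner_cmul_left: "coeff_inner E (\<lambda>xs. c * \<alpha> xs) \<beta> = c * coeff_inner E \<alpha> \<beta>"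
  by (simp add: coeff_inner_def sum_distrib_left algebra_simps)

lemma coeff_inner_commute: "coeff_inner E \<alpha> \<beta> = coeff_inner E \<beta> \<alpha>"
  by (simp add: coeff_inner_def mult.commute)

text \<open>
  For an orthonormal basis \<open>E\<close> the vector on the right is \<open>v\<close>. The form given here, with a sum over
  \<open>E\<close> in its place, also makes sense for the tails of \<open>E\<close> and so can be proved by induction on \<open>E\<close>.
\<close>

lemma ext_mult_adjoint:
  assumes "\<beta> \<in> forms k"
  shows "coeff_inner E (ext_mult v \<gamma>) \<beta> = coeff_inner E \<gamma> (contract (\<Sum>e\<leftarrow>E. (e \<bullet> v) *\<^sub>R e) \<beta>)"
  using assms
proof (induction E arbitrary: \<gamma> \<beta> k)
  case Nil
  then show ?case
    using linear_0[OF forms_linear_Cons[OF Nil, of "[]"]] by (simp add: coeff_inner_Nil contract_def)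
next
  case (Cons e E)
  define P where "P = (\<Sum>e\<leftarrow>E. (e \<bullet> v) *\<^sub>R e)"
  have add: "contract (c *\<^sub>R e + P) \<omega> = (\<lambda>xs. c * contract e \<omega> xs + contract P \<omega> xs)"
    if "\<omega> \<in> forms j" for \<omega> j c
    by (rule HOL.ext) (use forms_combine[OF that, of "[]"] in \<open>simp add: contract_def\<close>)
  have right: "coeff_inner E \<gamma>' (\<lambda>xs. c * \<alpha> xs + \<alpha>' xs) = c * coeff_inner E \<gamma>' \<alpha> + coeff_inner E \<gamma>' \<alpha>'" for \<gamma>' c \<alpha> \<alpha>'
    by (subst (1 2 3) coeff_inner_commute) (simp add: coeff_inner_add_left coeff_inner_cmul_left)
  have neg: "coeff_inner E \<gamma>' (\<lambda>xs. - \<alpha> xs) = - coeff_inner E \<gamma>' \<alpha>" for \<gamma>' \<alpha>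
    by (simp add: coeff_inner_def sum_negf)
  have "contract e (ext_mult v \<gamma>) = (\<lambda>xs. (e \<bullet> v) * \<gamma> xs + (-1) * ext_mult v (contract e \<gamma>) xs)"
    by (rule ext) (simp add: contract_def[of e "ext_mult v \<gamma>"] ext_mult_Cons)
  then have "coeff_inner E (contract e (ext_mult v \<gamma>)) (contract e \<beta>) =
      (e \<bullet> v) * coeff_inner E \<gamma> (contract e \<beta>) + (-1) * coeff_inner E (ext_mult v (contract e \<gamma>)) (contract e \<beta>)"
    by (simp only: coeff_inner_add_left coeff_inner_cmul_left)
  also have "coeff_inner E (ext_mult v (contract e \<gamma>)) (contract e \<beta>) =
      coeff_inner E (contract e \<gamma>) (contract P (contract e \<beta>))"
    unfolding P_def by (rule Cons.IH[OF forms_contract[OF Cons.prems]])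
  also have "\<dots> = - coeff_inner E (contract e \<gamma>) (contract e (contract P \<beta>))"
    by (subst contract_anticommute[OF Cons.prems]) (rule neg)
  finally have "coeff_inner (e # E) (ext_mult v \<gamma>) \<beta> = coeff_inner E \<gamma> (contract P \<beta>) +
      (e \<bullet> v) * coeff_inner E \<gamma> (contract e \<beta>) + coeff_inner E (contract e \<gamma>) (contract e (contract P \<beta>))"
    using Cons.IH[OF Cons.prems, of \<gamma>] by (simp add: coeff_inner_Cons P_def)
  \<comment> \<open>The part of the vector along \<open>e\<close> drops out of the double contraction.\<close>
  moreover have "contract e (contract ((e \<bullet> v) *\<^sub>R e + P) \<beta>) = contract e (contract P \<beta>)"
    unfolding add[OF Cons.prems] by (rule ext) (simp add: contract_def forms_repeat[OF Cons.prems])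
  ultimately have "coeff_inner (e # E) (ext_mult v \<gamma>) \<beta> = coeff_inner (e # E) \<gamma> (contract ((e \<bullet> v) *\<^sub>R e + P) \<beta>)"
    by (simp add: coeff_inner_Cons add[OF Cons.prems] right)
  then show ?case by (simp add: P_def)
qed

section \<open>Orthonormal bases\<close>

lemma orthonormal_basis_exists:
  assumes "finite_dimensional TYPE('v::real_inner)"
  shows "\<exists>E :: 'v list. orthonormal_basis E"
proof -
  obtain B :: "'v set" where "finite B" "span B = UNIV"
    using assms by (auto simp: finite_dimensional_def)
  then obtain C :: "'v set" where C: "finite C" "span C = UNIV" "pairwise orthogonal C"
    using basis_orthogonal[of B] by auto
  define N where "N = (\<lambda>x::'v. x /\<^sub>R norm x) ` (C - {0})"
  have "finite N" using C by (simp add: N_def)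
  then obtain E where E: "set E = N" "distinct E"
    using finite_distinct_list by blast
  have "x \<in> span N" if "x \<in> C" for x
  proof (cases "x = 0")
    case False
    then have "norm x *\<^sub>R (x /\<^sub>R norm x) \<in> span N"
      using that by (intro span_scale span_base) (auto simp: N_def)
    then show ?thesis using False by simp
  qed (simp add: span_zero)
  then have "span N = UNIV"
    using C(2) span_minimal[of C "span N"] by auto
  moreover have "E ! i \<bullet> E ! j = (if i = j then 1 else 0)" if "i < length E" "j < length E" for i j
  proof -
    have "E ! i \<in> N" "E ! j \<in> N" using that E by auto
    then obtain x y where x: "x \<in> C - {0}" "E ! i = x /\<^sub>R norm x"
      and y: "y \<in> C - {0}" "E ! j = y /\<^sub>R norm y"
      by (auto simp: N_def)
    show ?thesis
    proof (cases "i = j")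
      case True
      then have "norm (E ! i) = 1" using x by simp
      then show ?thesis using True by (simp add: norm_eq_1)
    next
      case False
      then have "E ! i \<noteq> E ! j" using E(2) that by (simp add: nth_eq_iff_index_eq)
      then have "x \<bullet> y = 0"
        using x y C(3) by (auto simp: pairwise_def orthogonal_def)
      then show ?thesis using False x y by simp
    qed
  qed
  ultimately have "orthonormal_basis E"
    using E(1) unfolding orthonormal_basis_def by simp
  then show ?thesis ..
qed

context
  fixes E :: "'v::real_inner list"
  assumes E: "orthonormal_basis E"
begin

lemma orthonormal_basis_distinct: "distinct E"
  using E unfolding orthonormal_basis_def distinct_conv_nth by (metis zero_neq_one)

lemma orthonormal_basis_inner:
  assumes "u \<in> set E" "v \<in> set E" shows "u \<bullet> v = (if u = v then 1 else 0)"
proof -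
  obtain i j where "i < length E" "j < length E" "u = E ! i" "v = E ! j"
    using assms by (auto simp: in_set_conv_nth)
  then show ?thesis
    using E orthonormal_basis_distinct by (simp add: orthonormal_basis_def nth_eq_iff_index_eq)
qed

lemma orthonormal_basis_length: "length E = dim (UNIV :: 'v set)"
proof -
  have "0 \<notin> set E" using orthonormal_basis_inner[of 0 0] by auto
  then have "independent (set E)"
    by (intro pairwise_orthogonal_independent)
      (auto simp: pairwise_def orthogonal_def orthonormal_basis_inner)
  then show ?thesis
    using E dim_eq_card[of "set E" UNIV] orthonormal_basis_distinct
    by (simp add: orthonormal_basis_def distinct_card)
qed

lemma orthonormal_basis_expansion: "(\<Sum>e\<in>set E. (e \<bullet> v) *\<^sub>R e) = v"
proof -
  define w where "w = v - (\<Sum>e\<in>set E. (e \<bullet> v) *\<^sub>R e)"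
  have "orthogonal w u" if "u \<in> set E" for u
  proof -
    have "(\<Sum>e\<in>set E. (e \<bullet> v) * (e \<bullet> u)) = (\<Sum>e\<in>set E. if e = u then e \<bullet> v else 0)"
      using that by (intro sum.cong) (auto simp: orthonormal_basis_inner)
    then show ?thesis
      using that by (simp add: w_def orthogonal_def inner_diff_left inner_sum_left inner_commute[of v])
  qed
  then have "orthogonal w w"
    using E orthogonal_to_span[of w "set E" w] by (auto simp: orthonormal_basis_def)
  then show ?thesis by (simp add: w_def orthogonal_def)
qed

lemma orthonormal_basis_expansion_list: "(\<Sum>e\<leftarrow>E. (e \<bullet> v) *\<^sub>R e) = v"
  using orthonormal_basis_expansion orthonormal_basis_distinct
  by (simp add: sum_list_distinct_conv_sum_set)

end

section \<open>The star operator as contraction of the volume form\<close>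

lemma ext_mult_append:
  "ext_mult v \<omega> (ys @ xs) =
     ext_mult v (\<lambda>zs. \<omega> (zs @ xs)) ys + (-1) ^ length ys * ext_mult v (\<lambda>zs. \<omega> (ys @ zs)) xs"
  by (induction ys arbitrary: \<omega>) (simp_all add: ext_mult_Cons contract_def)

lemma ext_mult_cmul: "ext_mult v (\<lambda>xs. c * \<alpha> xs) xs = c * ext_mult v \<alpha> xs"
  by (simp add: ext_mult_def sum_distrib_left algebra_simps)

lemma ext_mult_sum: "ext_mult v (\<lambda>xs. \<Sum>i\<in>A. \<alpha> i xs) xs = (\<Sum>i\<in>A. ext_mult v (\<alpha> i) xs)"
  unfolding ext_mult_def sum_distrib_left by (rule sum.swap)

locale volume_form =
  fixes E :: "'v::real_inner list" and \<epsilon> :: "'v form"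
  assumes basis: "orthonormal_basis E"
    and top: "\<epsilon> \<in> forms (int (length E))"
    and nonzero: "\<epsilon> E \<noteq> 0"
begin

lemma forms_eqI:
  assumes "\<alpha> \<in> forms k" "\<beta> \<in> forms k"
    and "\<And>I. I \<subseteq> {..<length E} \<Longrightarrow> \<alpha> (nths E I) = \<beta> (nths E I)"
  shows "\<alpha> = \<beta>"
proof
  fix xs
  have "(\<lambda>xs. \<alpha> xs + - \<beta> xs) \<in> forms k"
    by (intro forms_add forms_uminus assms)
  then have "\<alpha> xs + - \<beta> xs = 0"
    by (rule form_zero_span[where E = E]) (use basis assms(3) in \<open>simp_all add: orthonormal_basis_def\<close>)
  then show "\<alpha> xs = \<beta> xs" by simp
qed

lemma length_nths_le: "length (nths E I) \<le> length E"
  unfolding length_nths using card_mono[of "{..<length E}" "{i. i < length E \<and> i \<in> I}"] by auto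

lemma forms_above_top:
  fixes \<omega> :: "'v form"
  assumes "\<omega> \<in> forms k" "int (length E) < k" shows "\<omega> = (\<lambda>_. 0)"
proof (rule forms_eqI[OF assms(1) forms_zero])
  fix I
  show "\<omega> (nths E I) = 0"
    using length_nths_le[of I] assms(2) by (intro forms_length[OF assms(1)]) linarith
qed

lemma top_forms_eqI:
  assumes "\<alpha> \<in> forms (int (length E))" "\<beta> \<in> forms (int (length E))" "\<alpha> E = \<beta> E"
  shows "\<alpha> = \<beta>"
proof (rule forms_eqI[OF assms(1,2)])
  fix I assume I: "I \<subseteq> {..<length E}"
  show "\<alpha> (nths E I) = \<beta> (nths E I)"
  proof (cases "I = {..<length E}")
    case True
    then show ?thesis using assms(3) by (simp add: nths_all)
  next
    case False
    then have "card I < card {..<length E}" using I by (intro psubset_card_mono) auto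
    then have "length (nths E I) \<noteq> length E" using length_nths_subset[OF I] by simp
    then show ?thesis using forms_length[OF assms(1)] forms_length[OF assms(2)] by simp
  qed
qed

text \<open>
  Of all pairs of coefficient tuples, the volume form sees only the complementary ones: it vanishes
  on repeated vectors and on lists that are not of length \<open>n\<close>.
\<close>

lemma volume_complement:
  assumes "I \<subseteq> {..<length E}" "J \<subseteq> {..<length E}" "\<epsilon> (nths E I @ nths E J) \<noteq> 0"
  shows "J = {..<length E} - I"
proof (rule card_subset_eq)
  have "distinct (nths E I @ nths E J)"
    using assms(3) forms_repeat[OF top] by blast
  then have "I \<inter> J = {}"
    using assms(1,2) by (auto simp: set_nths disjoint_iff)
  then show "J \<subseteq> {..<length E} - I" using assms(2) by auto
  have "int (length (nths E I @ nths E J)) = int (length E)"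
    using assms(3) forms_length[OF top] by blast
  then have "card I + card J = length E"
    using assms(1,2) by (simp add: length_nths_subset)
  then show "card J = card ({..<length E} - I)"
    using assms(1) by (simp add: card_Diff_subset finite_subset)
qed simp

text \<open>
  The contraction of the volume form with \<open>\<beta>\<close>, an explicit formula for \<open>*\<beta>\<close>.
\<close>

definition hodge :: "'v form \<Rightarrow> 'v form" where
  "hodge \<beta> = (\<lambda>xs. coeff_inner E \<beta> (\<lambda>ys. \<epsilon> (ys @ xs)))"

lemma forms_hodge:
  assumes "\<beta> \<in> forms p" shows "hodge \<beta> \<in> forms (int (length E) - p)"
  unfolding hodge_def coeff_inner_def
proof (rule forms_sum)
  fix I assume "I \<in> Pow {..<length E}"
  show "(\<lambda>xs. \<beta> (nths E I) * \<epsilon> (nths E I @ xs)) \<in> forms (int (length E) - p)"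
  proof (cases "int (length (nths E I)) = p")
    case True
    then show ?thesis
      using forms_embed[OF top, of "nths E I" "[]"] by (intro forms_cmul) simp
  qed (simp add: forms_length[OF assms] forms_zero)
qed

lemma hodge_basis:
  assumes "S \<subseteq> {..<length E}"
  shows "hodge \<beta> (nths E ({..<length E} - S)) = \<beta> (nths E S) * ((-1) ^ inversions (length E) S * \<epsilon> E)"
proof -
  have "\<epsilon> (nths E I @ nths E ({..<length E} - S)) = 0" if "I \<in> Pow {..<length E} - {S}" for I
    using volume_complement[of I "{..<length E} - S"] that assms by auto
  then have "hodge \<beta> (nths E ({..<length E} - S)) =
      (\<Sum>I\<in>{S}. \<beta> (nths E I) * \<epsilon> (nths E I @ nths E ({..<length E} - S)))"
    unfolding hodge_def coeff_inner_def using assms by (intro sum.mono_neutral_right) auto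
  then show ?thesis
    using forms_shuffle[OF top assms, of "[]"] by simp
qed

text \<open>
  Both sides are \<open>n\<close>-forms, so it suffices to evaluate them on \<open>E\<close>. There the shuffle sign of the
  exterior product cancels the one that rearranges the arguments of the volume form.
\<close>

lemma wedge_hodge:
  assumes "\<alpha> \<in> forms p" "\<beta> \<in> forms p"
  shows "wedge \<alpha> (hodge \<beta>) = (\<lambda>xs. coeff_inner E \<alpha> \<beta> * \<epsilon> xs)"
proof (rule top_forms_eqI)
  show "wedge \<alpha> (hodge \<beta>) \<in> forms (int (length E))"
    using forms_wedge[OF assms(1) forms_hodge[OF assms(2)]] by simp
  show "(\<lambda>xs. coeff_inner E \<alpha> \<beta> * \<epsilon> xs) \<in> forms (int (length E))"
    by (rule forms_cmul[OF top])
  have sq: "(-1) ^ m * ((-1) ^ m * c) = (c :: real)" for m c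
    by (simp add: mult.assoc[symmetric] power_mult_distrib[symmetric])
  show "wedge \<alpha> (hodge \<beta>) E = coeff_inner E \<alpha> \<beta> * \<epsilon> E"
    unfolding wedge_eq coeff_inner_def sum_distrib_right
    by (rule sum.cong) (simp_all add: hodge_basis algebra_simps sq)
qed

text \<open>
  The coefficient of \<open>\<gamma>\<close> at \<open>K\<close> is detected by wedging with \<open>\<epsilon>(e\<^sub>K, \<dots>)\<close>, a multiple of the basis form
  of the complement of \<open>K\<close>.
\<close>

lemma wedge_nondegenerate:
  fixes \<gamma> \<gamma>' :: "'v form"
  assumes "\<gamma> \<in> forms (int (length E) - p)" "\<gamma>' \<in> forms (int (length E) - p)"
    and eq: "\<And>\<alpha>. \<alpha> \<in> forms p \<Longrightarrow> wedge \<alpha> \<gamma> = wedge \<alpha> \<gamma>'"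
  shows "\<gamma> = \<gamma>'"
proof (rule forms_eqI[OF assms(1,2)])
  fix K assume K: "K \<subseteq> {..<length E}"
  define K' where "K' = {..<length E} - K"
  have K': "{..<length E} - K' = K" "K' \<subseteq> {..<length E}" using K by (auto simp: K'_def)
  define \<alpha> where "\<alpha> = (\<lambda>xs. \<epsilon> (nths E K @ xs))"
  \<comment> \<open>Only the complement of \<open>K\<close> contributes to the sum over shuffles.\<close>
  have "\<alpha> (nths E S) = 0" if "S \<in> Pow {..<length E} - {K'}" for S
    using volume_complement[OF K, of S] that by (auto simp: \<alpha>_def K'_def)
  then have wedge: "wedge \<alpha> \<omega> E =
      (\<Sum>S\<in>{K'}. (-1) ^ inversions (length E) S * \<alpha> (nths E S) * \<omega> (nths E ({..<length E} - S)))" for \<omega>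
    unfolding wedge_eq using K' by (intro sum.mono_neutral_right) auto
  have "\<alpha> (nths E K') \<noteq> 0"
    using forms_shuffle[OF top K, of "[]"] nonzero by (simp add: \<alpha>_def K'_def)
  show "\<gamma> (nths E K) = \<gamma>' (nths E K)"
  proof (cases "int (length (nths E K)) = int (length E) - p")
    case True
    then have "\<alpha> \<in> forms p"
      using forms_embed[OF top, of "nths E K" "[]"] by (simp add: \<alpha>_def)
    then have "wedge \<alpha> \<gamma> E = wedge \<alpha> \<gamma>' E" by (simp add: eq)
    then show ?thesis using \<open>\<alpha> (nths E K') \<noteq> 0\<close> by (simp add: wedge K')
  qed (simp add: forms_length[OF assms(1)] forms_length[OF assms(2)])
qed

text \<open>
  Adjointness moves \<open>v\<close> into the first slot of the volume form, in front of the \<open>p\<close> vectors that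
  are paired with \<open>\<alpha>\<close>; the sign comes from moving it behind them.
\<close>

lemma hodge_ext_mult:
  assumes "\<alpha> \<in> forms (int p)"
  shows "hodge (ext_mult v \<alpha>) = (\<lambda>xs. (-1) ^ p * contract v (hodge \<alpha>) xs)"
proof
  fix xs
  have "(\<lambda>ys. \<epsilon> (ys @ xs)) \<in> forms (int (length E) - int (length xs))"
    using forms_embed[OF top, of "[]" xs] by simp
  then have "hodge (ext_mult v \<alpha>) xs = coeff_inner E \<alpha> (\<lambda>ys. \<epsilon> (v # ys @ xs))"
    unfolding hodge_def ext_mult_adjoint orthonormal_basis_expansion_list[OF basis]
    by (simp add: ext_mult_adjoint orthonormal_basis_expansion_list[OF basis] contract_def)
  also have "\<dots> = (-1) ^ p * coeff_inner E \<alpha> (\<lambda>ys. \<epsilon> (ys @ v # xs))"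
    unfolding coeff_inner_def sum_distrib_left
  proof (rule sum.cong[OF refl])
    fix I
    show "\<alpha> (nths E I) * \<epsilon> (v # nths E I @ xs) = (-1) ^ p * (\<alpha> (nths E I) * \<epsilon> (nths E I @ v # xs))"
    proof (cases "length (nths E I) = p")
      case True
      then show ?thesis using forms_move[OF top, of "[]" "nths E I" v xs] by simp
    qed (simp add: forms_length[OF assms])
  qed
  finally show "hodge (ext_mult v \<alpha>) xs = (-1) ^ p * contract v (hodge \<alpha>) xs"
    by (simp add: hodge_def contract_def)
qed

text \<open>
  Adjointness turns the contraction of \<open>\<beta>\<close> into exterior multiplication of \<open>\<epsilon>\<close> in its first
  \<open>q\<close> arguments. As \<open>v \<wedge> \<epsilon> = 0\<close>, this is up to sign exterior multiplication in the remaining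
  arguments, which are those of \<open>*\<beta>\<close>. The exponent is \<open>q + 1\<close> instead of \<open>q - 1\<close> so that \<open>q = 0\<close>, where
  both sides vanish, is covered without truncated subtraction.
\<close>

lemma hodge_contract:
  assumes "\<beta> \<in> forms (int q)"
  shows "hodge (contract v \<beta>) = (\<lambda>xs. (-1) ^ (q + 1) * ext_mult v (hodge \<beta>) xs)"
proof
  fix xs
  have "hodge (contract v \<beta>) xs = coeff_inner E (ext_mult v (\<lambda>ys. \<epsilon> (ys @ xs))) \<beta>"
    unfolding hodge_def ext_mult_adjoint[OF assms] orthonormal_basis_expansion_list[OF basis]
    by (rule coeff_inner_commute)
  also have "\<dots> = (\<Sum>I\<in>Pow {..<length E}. (-1) ^ (q + 1) *
      (\<beta> (nths E I) * ext_mult v (\<lambda>zs. \<epsilon> (nths E I @ zs)) xs))"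
    unfolding coeff_inner_def
  proof (rule sum.cong[OF refl])
    fix I
    have "ext_mult v \<epsilon> = (\<lambda>_. 0)"
      by (rule forms_above_top[OF forms_ext_mult[OF top]]) simp
    then have "ext_mult v (\<lambda>ys. \<epsilon> (ys @ xs)) (nths E I) +
        (-1) ^ length (nths E I) * ext_mult v (\<lambda>zs. \<epsilon> (nths E I @ zs)) xs = 0"
      using ext_mult_append[of v \<epsilon> "nths E I" xs] by simp
    then have "ext_mult v (\<lambda>ys. \<epsilon> (ys @ xs)) (nths E I) =
        - ((-1) ^ length (nths E I) * ext_mult v (\<lambda>zs. \<epsilon> (nths E I @ zs)) xs)"
      by linarith
    then show "ext_mult v (\<lambda>ys. \<epsilon> (ys @ xs)) (nths E I) * \<beta> (nths E I) =
        (-1) ^ (q + 1) * (\<beta> (nths E I) * ext_mult v (\<lambda>zs. \<epsilon> (nths E I @ zs)) xs)"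
      by (cases "length (nths E I) = q") (simp_all add: forms_length[OF assms])
  qed
  also have "\<dots> = (-1) ^ (q + 1) * ext_mult v (hodge \<beta>) xs"
    by (simp add: hodge_def coeff_inner_def ext_mult_sum ext_mult_cmul sum_distrib_left)
  finally show "hodge (contract v \<beta>) xs = (-1) ^ (q + 1) * ext_mult v (hodge \<beta>) xs" .
qed

end

section \<open>The Bianchi operator and the star on double forms\<close>

text \<open>
  The vector that moves from the first argument list to the second is expanded in the basis. The
  minus sign is due to the Bianchi operator counting positions from \<open>1\<close>.
\<close>

lemma bianchi_tensor_sum:
  assumes "orthonormal_basis E" "\<And>k. k \<in> A \<Longrightarrow> \<beta> k \<in> forms b"
  shows "bianchi (\<lambda>xs ys. \<Sum>k\<in>A. tensor (\<alpha> k) (\<beta> k) xs ys) =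
    (\<lambda>xs ys. \<Sum>(k, e)\<in>A \<times> set E. tensor (\<lambda>xs. - ext_mult e (\<alpha> k) xs) (contract e (\<beta> k)) xs ys)"
proof (intro ext)
  fix xs ys
  have "\<beta> k (xs ! l # ys) = (\<Sum>e\<in>set E. (xs ! l \<bullet> e) * \<beta> k (e # ys))" if "k \<in> A" for k l
  proof -
    define x where "x = xs ! l"
    have lin: "linear (\<lambda>v. \<beta> k (v # ys))"
      by (rule forms_linear_Cons[OF assms(2)[OF that]])
    have "\<beta> k (x # ys) = \<beta> k ((\<Sum>e\<in>set E. (e \<bullet> x) *\<^sub>R e) # ys)"
      by (simp add: orthonormal_basis_expansion[OF assms(1)])
    also have "\<dots> = (\<Sum>e\<in>set E. (x \<bullet> e) * \<beta> k (e # ys))"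
      using linear_sum[OF lin, of "\<lambda>e. (e \<bullet> x) *\<^sub>R e" "set E"] linear_scale[OF lin]
      by (simp add: inner_commute[of x])
    finally show ?thesis by (simp add: x_def)
  qed
  then have "bianchi (\<lambda>xs ys. \<Sum>k\<in>A. tensor (\<alpha> k) (\<beta> k) xs ys) xs ys =
      (\<Sum>l<length xs. \<Sum>k\<in>A. \<Sum>e\<in>set E. (-1) ^ (l + 1) *
        (\<alpha> k (take l xs @ drop (l + 1) xs) * ((xs ! l \<bullet> e) * \<beta> k (e # ys))))"
    by (simp add: bianchi_def tensor_def sum_distrib_left sum_negf[symmetric] cong: sum.cong)
  also have "\<dots> = (\<Sum>k\<in>A. \<Sum>e\<in>set E. \<Sum>l<length xs. (-1) ^ (l + 1) *
        (\<alpha> k (take l xs @ drop (l + 1) xs) * ((xs ! l \<bullet> e) * \<beta> k (e # ys))))"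
    by (subst sum.swap, rule sum.cong[OF refl], rule sum.swap)
  also have "\<dots> = (\<Sum>k\<in>A. \<Sum>e\<in>set E. - ext_mult e (\<alpha> k) xs * contract e (\<beta> k) ys)"
    by (simp add: ext_mult_def contract_def sum_distrib_left sum_distrib_right sum_negf[symmetric] algebra_simps)
  finally show "bianchi (\<lambda>xs ys. \<Sum>k\<in>A. tensor (\<alpha> k) (\<beta> k) xs ys) xs ys =
      (\<Sum>(k, e)\<in>A \<times> set E. tensor (\<lambda>xs. - ext_mult e (\<alpha> k) xs) (contract e (\<beta> k)) xs ys)"
    by (simp add: sum.cartesian_product tensor_def)
qed

lemma double_forms_tensor_sum:
  assumes "finite A" "\<And>k. k \<in> A \<Longrightarrow> \<alpha> k \<in> forms a" "\<And>k. k \<in> A \<Longrightarrow> \<beta> k \<in> forms b"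
  shows "(\<lambda>xs ys. \<Sum>k\<in>A. tensor (\<alpha> k) (\<beta> k) xs ys) \<in> double_forms a b"
proof -
  obtain h where h: "bij_betw h {..<card A} A"
    using ex_bij_betw_nat_finite[OF assms(1)] by (auto simp: atLeast0LessThan)
  have "tensor_rep a b (\<lambda>xs ys. \<Sum>k\<in>A. tensor (\<alpha> k) (\<beta> k) xs ys) (card A) (\<alpha> \<circ> h) (\<beta> \<circ> h)"
    unfolding tensor_rep_def sum.reindex_bij_betw[OF h, symmetric]
    using bij_betwE[OF h] assms(2,3) by auto
  then show ?thesis by (auto simp: double_forms_def)
qed

context
  fixes \<epsilon> :: "'v::real_inner form"
  assumes fin: "finite_dimensional TYPE('v)" and vol: "volume_element \<epsilon>"
begin

lemma orthonormal_basis_onb: "orthonormal_basis (onb :: 'v list)"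
  unfolding onb_def using orthonormal_basis_exists[OF fin] by (rule someI_ex)

lemma form_inner_eq: "form_inner = coeff_inner (onb :: 'v list)"
  by (simp add: fun_eq_iff form_inner_def coeff_inner_def)

interpretation volume_form onb \<epsilon>
proof
  have length: "length (onb :: 'v list) = dim (UNIV :: 'v set)"
    by (rule orthonormal_basis_length[OF orthonormal_basis_onb])
  then show top: "\<epsilon> \<in> forms (int (length (onb :: 'v list)))"
    using vol by (simp add: volume_element_def)
  show "\<epsilon> onb \<noteq> 0"
  proof
    assume zero: "\<epsilon> onb = 0"
    have "\<epsilon> (nths onb I) = 0" if "I \<in> Pow {..<length (onb :: 'v list)}" for I
    proof (cases "I = {..<length (onb :: 'v list)}")
      case True
      then show ?thesis using zero by (simp add: nths_all)
    next
      case False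
      then have "card I < card {..<length (onb :: 'v list)}"
        using that by (intro psubset_card_mono) auto
      then show ?thesis
        using that by (intro forms_length[OF top]) (simp add: length_nths_subset)
    qed
    then show False
      using vol by (simp add: volume_element_def form_inner_def)
  qed
qed (rule orthonormal_basis_onb)

text \<open>
  The formula has the property that defines the star, and nondegeneracy makes it the only such form.
\<close>

lemma star_eq_hodge:
  assumes "\<beta> \<in> forms p" shows "star \<epsilon> p \<beta> = hodge \<beta>"
  unfolding star_def form_inner_eq orthonormal_basis_length[OF orthonormal_basis_onb, symmetric]
proof (rule the_equality)
  show "hodge \<beta> \<in> forms (int (length (onb :: 'v list)) - p) \<and>
      (\<forall>\<alpha>\<in>forms p. wedge \<alpha> (hodge \<beta>) = (\<lambda>xs. coeff_inner onb \<alpha> \<beta> * \<epsilon> xs))"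
    using forms_hodge[OF assms] wedge_hodge[OF _ assms] by blast
  then show "\<gamma> = hodge \<beta>" if "\<gamma> \<in> forms (int (length (onb :: 'v list)) - p) \<and>
      (\<forall>\<alpha>\<in>forms p. wedge \<alpha> \<gamma> = (\<lambda>xs. coeff_inner onb \<alpha> \<beta> * \<epsilon> xs))" for \<gamma>
    using that by (intro wedge_nondegenerate[of \<gamma> p]) auto
qed

text \<open>
  The star on double forms is defined through a representation by tensors. The formula for the star
  gives the value \<open>\<Sum>\<^sub>I \<Sum>\<^sub>J T(e\<^sub>I, e\<^sub>J) \<epsilon>(e\<^sub>I, xs) \<epsilon>(e\<^sub>J, ys)\<close> for every representation, so the definite
  description is justified and any index set may be used.
\<close>

lemma dstar_tensor_sum:
  assumes "finite A" "\<And>k. k \<in> A \<Longrightarrow> \<alpha> k \<in> forms a" "\<And>k. k \<in> A \<Longrightarrow> \<beta> k \<in> forms b"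
  shows "dstar \<epsilon> a b (\<lambda>xs ys. \<Sum>k\<in>A. tensor (\<alpha> k) (\<beta> k) xs ys) =
    (\<lambda>xs ys. \<Sum>k\<in>A. tensor (hodge (\<alpha> k)) (hodge (\<beta> k)) xs ys)"
proof -
  let ?P = "Pow {..<length (onb :: 'v list)}" and ?e = "\<lambda>I. nths (onb :: 'v list) I"
  define D where "D T = (\<lambda>xs ys. \<Sum>I\<in>?P. \<Sum>J\<in>?P. T (?e I) (?e J) * \<epsilon> (?e I @ xs) * \<epsilon> (?e J @ ys))"
    for T :: "'v dform"
  have D: "D (\<lambda>xs ys. \<Sum>k\<in>K. tensor (f k) (g k) xs ys) =
      (\<lambda>xs ys. \<Sum>k\<in>K. tensor (hodge (f k)) (hodge (g k)) xs ys)" for K :: "'k set" and f g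
  proof (intro HOL.ext)
    fix xs ys
    have "D (\<lambda>xs ys. \<Sum>k\<in>K. tensor (f k) (g k) xs ys) xs ys =
        (\<Sum>I\<in>?P. \<Sum>J\<in>?P. \<Sum>k\<in>K. (f k (?e I) * \<epsilon> (?e I @ xs)) * (g k (?e J) * \<epsilon> (?e J @ ys)))"
      by (simp add: D_def tensor_def sum_distrib_left sum_distrib_right algebra_simps)
    also have "\<dots> = (\<Sum>I\<in>?P. \<Sum>k\<in>K. \<Sum>J\<in>?P. (f k (?e I) * \<epsilon> (?e I @ xs)) * (g k (?e J) * \<epsilon> (?e J @ ys)))"
      by (rule sum.cong[OF refl], rule sum.swap)
    also have "\<dots> = (\<Sum>k\<in>K. \<Sum>I\<in>?P. \<Sum>J\<in>?P. (f k (?e I) * \<epsilon> (?e I @ xs)) * (g k (?e J) * \<epsilon> (?e J @ ys)))"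
      by (rule sum.swap)
    finally show "D (\<lambda>xs ys. \<Sum>k\<in>K. tensor (f k) (g k) xs ys) xs ys =
        (\<Sum>k\<in>K. tensor (hodge (f k)) (hodge (g k)) xs ys)"
      by (simp only: tensor_def hodge_def coeff_inner_def sum_product)
  qed
  have rep: "(\<lambda>xs ys. \<Sum>i<N. tensor (star \<epsilon> a (f i)) (star \<epsilon> b (g i)) xs ys) = D T"
    if "tensor_rep a b T N f g" for T N f g
  proof -
    have T: "T = (\<lambda>xs ys. \<Sum>i<N. tensor (f i) (g i) xs ys)"
      using that by (simp add: tensor_rep_def)
    show ?thesis
      unfolding T D using that by (intro HOL.ext sum.cong) (auto simp: tensor_rep_def star_eq_hodge)
  qed
  let ?T = "\<lambda>xs ys. \<Sum>k\<in>A. tensor (\<alpha> k) (\<beta> k) xs ys"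
  obtain N f g where "tensor_rep a b ?T N f g"
    using double_forms_tensor_sum[where \<alpha> = \<alpha> and \<beta> = \<beta>, OF assms]
    unfolding double_forms_def by blast
  then have "dstar \<epsilon> a b ?T = D ?T"
    unfolding dstar_def
    by (intro the_equality) (use rep in \<open>auto intro!: exI\<close>)
  then show ?thesis by (simp only: D)
qed

lemma star_bianchi_transpose:
  assumes "T \<in> double_forms (int p) (int q)"
  shows "dtranspose (dstar \<epsilon> (int p + 1) (int q - 1) (bianchi T)) =
           (\<lambda>xs ys. (-1) powi (int p + int q - 1) *
              bianchi (dstar \<epsilon> (int q) (int p) (dtranspose T)) xs ys)"
    and "dtranspose (dstar \<epsilon> (int p + 1) (int q - 1) (bianchi T))
           \<in> double_forms (int (dim (UNIV :: 'v set)) - int q + 1) (int (dim (UNIV :: 'v set)) - int p - 1)"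
proof -
  obtain N and \<alpha> \<beta> :: "nat \<Rightarrow> 'v form" where \<alpha>: "\<And>i. i < N \<Longrightarrow> \<alpha> i \<in> forms (int p)"
    and \<beta>: "\<And>i. i < N \<Longrightarrow> \<beta> i \<in> forms (int q)"
    and T: "T = (\<lambda>xs ys. \<Sum>i<N. tensor (\<alpha> i) (\<beta> i) xs ys)"
    using assms unfolding double_forms_def tensor_rep_def by blast
  let ?K = "{..<N} \<times> set (onb :: 'v list)"
  let ?L = "\<lambda>(i, e). hodge (\<lambda>xs. - ext_mult e (\<alpha> i) xs)"
  let ?R = "\<lambda>(i, e). hodge (contract e (\<beta> i))"
  note onb = orthonormal_basis_onb
  have b: "bianchi T = (\<lambda>xs ys. \<Sum>k\<in>?K. tensor ((\<lambda>(i, e) xs. - ext_mult e (\<alpha> i) xs) k)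
      ((\<lambda>(i, e). contract e (\<beta> i)) k) xs ys)"
    unfolding T using bianchi_tensor_sum[OF onb, of "{..<N}" \<beta> "int q" \<alpha>] \<beta>
    by (simp add: case_prod_unfold)
  have deg: "(\<lambda>(i, e) xs. - ext_mult e (\<alpha> i) xs) k \<in> forms (int p + 1)"
    "(\<lambda>(i, e). contract e (\<beta> i)) k \<in> forms (int q - 1)" if "k \<in> ?K" for k
    using that by (auto intro!: forms_uminus forms_ext_mult forms_contract \<alpha> \<beta>)
  have star_b: "dstar \<epsilon> (int p + 1) (int q - 1) (bianchi T) =
      (\<lambda>xs ys. \<Sum>k\<in>?K. tensor (?L k) (?R k) xs ys)"
    unfolding b by (subst dstar_tensor_sum[OF _ deg]) (simp_all add: case_prod_unfold)
  have "dtranspose T = (\<lambda>xs ys. \<Sum>i<N. tensor (\<beta> i) (\<alpha> i) xs ys)"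
    by (simp add: T dtranspose_def tensor_def mult.commute)
  then have "dstar \<epsilon> (int q) (int p) (dtranspose T) =
      (\<lambda>xs ys. \<Sum>i<N. tensor (hodge (\<beta> i)) (hodge (\<alpha> i)) xs ys)"
    using dstar_tensor_sum[of "{..<N}" \<beta> "int q" \<alpha> "int p"] \<alpha> \<beta> by simp
  then have b_star: "bianchi (dstar \<epsilon> (int q) (int p) (dtranspose T)) =
      (\<lambda>xs ys. \<Sum>(i, e)\<in>?K. tensor (\<lambda>xs. - ext_mult e (hodge (\<beta> i)) xs) (contract e (hodge (\<alpha> i))) xs ys)"
    by (simp only:) (rule bianchi_tensor_sum[OF onb forms_hodge[OF \<alpha>]], simp)
  have sign: "(-1 :: real) powi (int p + int q - 1) = (-1) ^ (p + q + 1)"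
    by (simp add: power_int_diff power_int_add power_add)
  have neg: "hodge (\<lambda>xs. - \<omega> xs) = (\<lambda>xs. - hodge \<omega> xs)" for \<omega>
    using coeff_inner_cmul_left[of onb "-1" \<omega>] by (simp add: hodge_def)
  \<comment> \<open>The sign is \<open>-(-1)\<^sup>p (-1)\<^sup>q\<^sup>+\<^sup>1\<close>; the first minus reappears in the Bianchi sum on the right.\<close>
  have summand: "?L k xs * ?R k ys = (-1) powi (int p + int q - 1) *
      (case k of (i, e) \<Rightarrow> - ext_mult e (hodge (\<beta> i)) ys * contract e (hodge (\<alpha> i)) xs)"
    if k: "k \<in> ?K" for k xs ys
  proof -
    obtain i e where "k = (i, e)" "i < N" using k by (cases k) auto
    then show ?thesis
      by (simp add: neg hodge_ext_mult[OF \<alpha>] hodge_contract[OF \<beta>] sign power_add)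
  qed
  show "dtranspose (dstar \<epsilon> (int p + 1) (int q - 1) (bianchi T)) =
      (\<lambda>xs ys. (-1) powi (int p + int q - 1) *
        bianchi (dstar \<epsilon> (int q) (int p) (dtranspose T)) xs ys)"
  proof (intro HOL.ext)
    fix xs ys
    have "dtranspose (dstar \<epsilon> (int p + 1) (int q - 1) (bianchi T)) xs ys = (\<Sum>k\<in>?K. ?L k ys * ?R k xs)"
      by (simp only: star_b dtranspose_def tensor_def)
    also have "\<dots> = (\<Sum>k\<in>?K. (-1) powi (int p + int q - 1) *
        (case k of (i, e) \<Rightarrow> - ext_mult e (hodge (\<beta> i)) xs * contract e (hodge (\<alpha> i)) ys))"
      by (rule sum.cong[OF refl summand])
    also have "\<dots> = (-1) powi (int p + int q - 1) *
        bianchi (dstar \<epsilon> (int q) (int p) (dtranspose T)) xs ys"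
      unfolding b_star sum_distrib_left[symmetric] by (simp add: tensor_def case_prod_unfold)
    finally show "dtranspose (dstar \<epsilon> (int p + 1) (int q - 1) (bianchi T)) xs ys =
        (-1) powi (int p + int q - 1) *
        bianchi (dstar \<epsilon> (int q) (int p) (dtranspose T)) xs ys" .
  qed
  have "dtranspose (dstar \<epsilon> (int p + 1) (int q - 1) (bianchi T)) =
      (\<lambda>xs ys. \<Sum>k\<in>?K. tensor (?R k) (?L k) xs ys)"
    by (simp add: star_b dtranspose_def tensor_def mult.commute)
  also have "\<dots> \<in> double_forms (int (length (onb :: 'v list)) - (int q - 1))
      (int (length (onb :: 'v list)) - (int p + 1))"
  proof (rule double_forms_tensor_sum)
    show "?R k \<in> forms (int (length (onb :: 'v list)) - (int q - 1))" if "k \<in> ?K" for k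
      using forms_hodge[OF deg(2)[OF that]] by (simp add: case_prod_unfold)
    show "?L k \<in> forms (int (length (onb :: 'v list)) - (int p + 1))" if "k \<in> ?K" for k
      using forms_hodge[OF deg(1)[OF that]] by (simp add: case_prod_unfold)
  qed simp
  finally show "dtranspose (dstar \<epsilon> (int p + 1) (int q - 1) (bianchi T))
      \<in> double_forms (int (dim (UNIV :: 'v set)) - int q + 1) (int (dim (UNIV :: 'v set)) - int p - 1)"
    by (simp add: orthonormal_basis_length[OF onb] algebra_simps)
qed

end

theorem proposition4p5:
  fixes n p q :: nat
    and \<epsilon> :: "'v::real_inner form"
    and T :: "'v dform"
  assumes "finite_dimensional TYPE('v)"
    and "n = dim (UNIV :: 'v set)"
    and "volume_element \<epsilon>"
    and "T \<in> double_forms (int p) (int q)"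
  shows "dtranspose (dstar \<epsilon> (int p + 1) (int q - 1) (bianchi T)) =
           (\<lambda>xs ys. (-1) powi (int p + int q - 1) *
              bianchi (dstar \<epsilon> (int q) (int p) (dtranspose T)) xs ys) \<and>
         dtranspose (dstar \<epsilon> (int p + 1) (int q - 1) (bianchi T))
           \<in> double_forms (int n - int q + 1) (int n - int p - 1)"
  using star_bianchi_transpose[OF assms(1,3,4)] assms(2) by simp

end
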